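(* Let $P=(p_1,p_2,\ldots)$ be a sequence of prime numbers and let $k\in\mathbb{N}$. Then the limit mapping $h^k_P:\Sigma_P\to\Sigma_P$ of the $P$-adic solenoid is a $k$-fold covering mapping if and only if $k$ has no prime divisor which occurs infinitely often in the sequence $P$.
   Context: $\mathbb{N}$ is the set of positive integers; $1$ is not a prime. $\mathbb{S}^1$ is the unit circle in $\mathbb{C}$. For a sequence $P=(p_1,p_2,\ldots)$ of prime numbers, the $P$-adic solenoid is the inverse limit $\Sigma_P=\{(z_1,z_2,\ldots)\in\prod_{n\ge 1}\mathbb{S}^1 : z_{n+1}^{p_n}=z_n \text{ for all } n\in\mathbb{N}\}$ with the topology induced from the product topology. For $k\in\mathbb{N}$ the limit mapping $h^k_P:\Sigma_P\to\Sigma_P$ is $h^k_P((z_1,z_2,\ldots))=(z_1^k,z_2^k,\ldots)$. A prime $p$ occurs infinitely often in $P$ if $p=p_n$ for infinitely many indices $n\in\mathbb{N}$. A surjective continuous mapping $f:X\to Y$ is a $k$-fold covering mapping if every point $y\in Y$ has an open neighborhood $W$ in $Y$ such that $f^{-1}(W)$ is the union of $k$ (pairwise) disjoint open subsets of $X$, each of which is mapped homeomorphically onto $W$ under $f$. *)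

theory Defs
  imports "HOL-Analysis.Analysis"
begin

text \<open>
  Sequences are indexed from \<open>0\<close>: \<open>P n\<close> and \<open>z n\<close> stand for \<open>p\<^sub>n\<^sub>+\<^sub>1\<close> and \<open>z\<^sub>n\<^sub>+\<^sub>1\<close>.
  The type \<^typ>\<open>nat \<Rightarrow> complex\<close> carries the product topology, so \<open>top_of_set (solenoid P)\<close>
  is the topology induced on the solenoid by the product of the circles.
\<close>

definition solenoid :: "(nat \<Rightarrow> nat) \<Rightarrow> (nat \<Rightarrow> complex) set" where
  "solenoid P = {z. (\<forall>n. z n \<in> sphere 0 1) \<and> (\<forall>n. z (Suc n) ^ P n = z n)}"

text \<open>The formula does not involve \<open>P\<close>; the map \<open>h\<^sup>k\<^sub>P\<close> is its restriction to \<open>solenoid P\<close>.\<close>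

definition limit_map :: "nat \<Rightarrow> (nat \<Rightarrow> complex) \<Rightarrow> (nat \<Rightarrow> complex)" where
  "limit_map k z = (\<lambda>n. z n ^ k)"

text \<open>
  This is \<^const>\<open>covering_space\<close> with the number of sheets fixed. Every sheet is homeomorphic
  to the nonempty set \<open>W\<close>, hence nonempty, so disjoint sheets are distinct and \<open>card \<V> = k\<close>
  counts them without repetition.
\<close>

definition kfold_covering_map ::
  "nat \<Rightarrow> 'a::topological_space set \<Rightarrow> 'b::topological_space set \<Rightarrow> ('a \<Rightarrow> 'b) \<Rightarrow> bool" where
  "kfold_covering_map k X Y f \<longleftrightarrow>
     continuous_on X f \<and> f ` X = Y \<and>
     (\<forall>y\<in>Y. \<exists>W. y \<in> W \<and> openin (top_of_set Y) W \<and>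
        (\<exists>\<V>. finite \<V> \<and> card \<V> = k \<and> \<Union>\<V> = X \<inter> f -` W \<and>
             (\<forall>V\<in>\<V>. openin (top_of_set X) V) \<and>
             pairwise disjnt \<V> \<and>
             (\<forall>V\<in>\<V>. \<exists>g. homeomorphism V W f g)))"

end

theory Submission
  imports Defs
begin

text \<open>
  A \<open>k\<close>-fold covering has fibres of size \<open>k\<close>. If a prime \<open>q\<close> dividing \<open>k = m q\<close> occurs infinitely often,
  then in the fibre over \<open>(1, 1, \<dots>)\<close> every coordinate is a \<open>q\<close>-th power of a \<open>k\<close>-th root of unity,
  hence an \<open>m\<close>-th root of unity; as a late coordinate separates the points of a finite fibre,
  the fibre has at most \<open>m < k\<close> points.
  Otherwise all \<open>P n\<close> with \<open>n \<ge> N\<close> are coprime to \<open>k\<close>, and a preimage of \<open>y\<close> is determined by its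
  \<open>N\<close>-th coordinate, which may be any \<open>k\<close>-th root of \<open>y N\<close>. Thus the limit map is the pullback, along
  the \<open>N\<close>-th coordinate, of the \<open>k\<close>-th power covering of the circle.
\<close>

section \<open>Powers with coprime exponents, and coordinates of the solenoid\<close>

text \<open>Bezout: if \<open>u * a + v * b = 1\<close>, then
  \<open>t = (t ^ a) powi u * (t ^ b) powi v\<close>. As \<open>u\<close> or \<open>v\<close> may be
  negative, \<open>t\<close> has to be nonzero.\<close>

lemma power_eq_coprime_imp_eq:
  fixes x y :: "'a::field"
  assumes "coprime a b" "x ^ a = y ^ a" "x ^ b = y ^ b" "x \<noteq> 0" "y \<noteq> 0"
  shows "x = y"
proof -
  obtain u v where uv: "u * int a + v * int b = 1"
    using bezout_int[of "int a" "int b"] assms(1) by auto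
  have "t = (t ^ a) powi u * (t ^ b) powi v" if "t \<noteq> 0" for t :: 'a
  proof -
    have "t = t powi (int a * u + int b * v)"
      using uv by (simp add: mult.commute)
    also have "\<dots> = (t ^ a) powi u * (t ^ b) powi v"
      using that by (simp add: power_int_add power_int_mult)
    finally show ?thesis .
  qed
  with assms show ?thesis by metis
qed

lemma norm_solenoid: "z \<in> solenoid P \<Longrightarrow> norm (z n) = 1"
  by (simp add: solenoid_def)

lemma solenoid_nonzero: "z \<in> solenoid P \<Longrightarrow> z n \<noteq> 0"
  by (metis norm_solenoid norm_zero zero_neq_one)

lemma solenoid_power_prod:
  assumes "z \<in> solenoid P" "n \<le> N"
  shows "z N ^ (\<Prod>i=n..<N. P i) = z n"
  using assms(2)
proof (induction N rule: dec_induct)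
  case (step m)
  have "z (Suc m) ^ P m = z m"
    using assms(1) by (simp add: solenoid_def)
  with step show ?case
    by (simp add: mult.commute power_mult)
qed simp

lemma continuous_on_coordinate: "continuous_on A (\<lambda>x::nat \<Rightarrow> complex. x n)"
  by (rule continuous_on_subset[OF continuous_on_product_coordinates]) simp

lemma limit_map_in_solenoid:
  assumes "z \<in> solenoid P"
  shows "limit_map k z \<in> solenoid P"
proof -
  have "(z (Suc n) ^ k) ^ P n = z n ^ k" for n
    using assms power_mult[of "z (Suc n)" k "P n"] power_mult[of "z (Suc n)" "P n" k]
    by (simp add: solenoid_def mult.commute)
  with assms show ?thesis
    by (simp add: solenoid_def limit_map_def norm_power)
qed

lemma continuous_on_limit_map: "continuous_on A (limit_map k)"
  unfolding limit_map_def
  by (intro continuous_on_coordinatewise_then_product continuous_intros continuous_on_coordinate)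

section \<open>Preimages under the limit map, determined by one coordinate\<close>

text \<open>Coordinates before \<open>N\<close> are powers of the \<open>N\<close>-th one. A later
  one has its \<open>k\<close>-th power fixed by the image and its power with exponent
  \<open>\<Prod>i=N..<n. P i\<close> fixed by the \<open>N\<close>-th coordinate, and these
  exponents are coprime.\<close>

lemma solenoid_eqI:
  assumes "z \<in> solenoid P" "z' \<in> solenoid P" "limit_map k z = limit_map k z'" "z N = z' N"
    and coprime: "\<And>n. n \<ge> N \<Longrightarrow> coprime (P n) k"
  shows "z = z'"
proof
  fix n
  show "z n = z' n"
  proof (cases "n \<le> N")
    case True
    with assms show ?thesis by (metis solenoid_power_prod)
  next
    case False
    have "coprime (\<Prod>i=N..<n. P i) k"
      by (intro prod_coprime_left coprime) auto
    moreover have "z n ^ k = z' n ^ k"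
      using assms(3) by (metis limit_map_def)
    moreover have "z n ^ (\<Prod>i=N..<n. P i) = z' n ^ (\<Prod>i=N..<n. P i)"
      using assms False by (simp add: solenoid_power_prod)
    ultimately show ?thesis
      using assms by (metis power_eq_coprime_imp_eq solenoid_nonzero)
  qed
qed

text \<open>
  Beyond index \<open>N\<close> the coordinate \<open>z n\<close> has prescribed powers with the coprime exponents
  \<open>k\<close> and \<open>\<Prod>i=N..<n. P i\<close>, namely \<open>y n\<close> and \<open>w\<close>, so Bezout coefficients express it
  continuously in these.
\<close>

lemma limit_map_lift:
  assumes coprime: "\<And>n. n \<ge> N \<Longrightarrow> coprime (P n) k"
  obtains s where
    "\<And>y w. y \<in> solenoid P \<Longrightarrow> w ^ k = y N \<Longrightarrow> norm w = 1 \<Longrightarrow>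
       s y w \<in> solenoid P \<and> limit_map k (s y w) = y \<and> s y w N = w"
    "\<And>A r. A \<subseteq> solenoid P \<Longrightarrow> continuous_on A r \<Longrightarrow> (\<And>y. y \<in> A \<Longrightarrow> r y \<noteq> 0) \<Longrightarrow>
       continuous_on A (\<lambda>y. s y (r y))"
proof -
  define Q where "Q n = (\<Prod>i=N..<n. P i)" for n
  have cop: "coprime k (Q n)" for n
    unfolding Q_def by (intro prod_coprime_right) (use coprime in \<open>auto simp: coprime_commute\<close>)
  have "\<exists>u v. u * int k + v * int (Q n) = 1" for n
    using bezout_int[of "int k" "int (Q n)"] cop[of n] by auto
  then obtain a b where ab: "\<And>n. a n * int k + b n * int (Q n) = 1"
    by metis
  define s where "s y w = (\<lambda>n. if n < N then w ^ (\<Prod>i=n..<N. P i)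
     else y n powi a n * w powi b n)" for y and w :: complex
  show thesis
  proof
    fix y w assume y: "y \<in> solenoid P" and w: "w ^ k = y N" and nw: "norm w = 1"
    have nz: "w \<noteq> 0" using nw by auto
    have ns: "norm (s y w n) = 1" for n
      using norm_solenoid[OF y] nw by (simp add: s_def norm_mult norm_power norm_power_int)
    then have sz: "s y w n \<noteq> 0" for n
      by (metis norm_zero zero_neq_one)
    have sk: "s y w n ^ k = y n" for n
    proof (cases "n < N")
      case True
      then show ?thesis
        using solenoid_power_prod[OF y, of n N] w
        by (simp add: s_def mult.commute flip: power_mult) (simp add: power_mult)
    next
      case False
      have "w ^ k = y n ^ Q n"
        using w False y by (simp add: Q_def solenoid_power_prod)
      have "s y w n ^ k = y n powi (a n * int k) * (w ^ k) powi b n"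
        using False by (simp add: s_def power_mult_distrib power_int_power power_int_power' mult.commute)
      also have "\<dots> = y n powi (a n * int k) * y n powi (b n * int (Q n))"
        unfolding \<open>w ^ k = y n ^ Q n\<close> by (simp add: power_int_power mult.commute)
      also have "\<dots> = y n"
        using ab[of n] solenoid_nonzero[OF y] by (simp flip: power_int_add)
      finally show ?thesis .
    qed
    have sQ: "s y w n ^ Q n = w" if "n \<ge> N" for n
    proof -
      have "y n ^ Q n = w ^ k"
        using w that y by (simp add: Q_def solenoid_power_prod)
      have "s y w n ^ Q n = (y n ^ Q n) powi a n * w powi (b n * int (Q n))"
        using that by (simp add: s_def power_mult_distrib power_int_power power_int_power' mult.commute)
      also have "\<dots> = w powi (a n * int k) * w powi (b n * int (Q n))"
        unfolding \<open>y n ^ Q n = w ^ k\<close> by (simp add: power_int_power mult.commute)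
      also have "\<dots> = w"
        using ab[of n] nz by (simp flip: power_int_add)
      finally show ?thesis .
    qed
    \<comment> \<open>The product is empty, so \<open>Q N = 1\<close>.\<close>
    have sN: "s y w N = w"
      using sQ[of N] by (simp add: Q_def)
    have "s y w (Suc n) ^ P n = s y w n" for n
    proof (cases "n < N")
      case True
      \<comment> \<open>At \<open>Suc n = N\<close> the other branch of \<open>s\<close> applies;
        there \<open>sN\<close> supplies the value \<open>w\<close>, matching the empty
        product.\<close>
      then have "s y w (Suc n) = w ^ (\<Prod>i=Suc n..<N. P i)"
        using sN by (cases "Suc n = N") (auto simp: s_def)
      with True show ?thesis
        by (simp add: s_def prod.atLeast_Suc_lessThan mult.commute flip: power_mult)
    next
      case False
      \<comment> \<open>Both sides of the required relation have the same powers with the coprime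
        exponents \<open>k\<close> and \<open>Q n\<close>, hence coincide.\<close>
      have "(s y w (Suc n) ^ P n) ^ k = y (Suc n) ^ P n"
        using sk[of "Suc n"] by (metis mult.commute power_mult)
      also have "\<dots> = s y w n ^ k"
        using y sk[of n] by (simp add: solenoid_def)
      finally have 1: "(s y w (Suc n) ^ P n) ^ k = s y w n ^ k" .
      have "Q (Suc n) = P n * Q n"
        using False by (simp add: Q_def)
      then have "(s y w (Suc n) ^ P n) ^ Q n = s y w n ^ Q n"
        using sQ[of n] sQ[of "Suc n"] False by (simp flip: power_mult)
      with 1 cop show ?thesis
        using sz by (metis power_eq_coprime_imp_eq power_not_zero)
    qed
    with ns sk sN show "s y w \<in> solenoid P \<and> limit_map k (s y w) = y \<and> s y w N = w"
      by (simp add: solenoid_def limit_map_def)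
  next
    fix A r assume A: "A \<subseteq> solenoid P" "continuous_on A r" "\<And>y. y \<in> A \<Longrightarrow> r y \<noteq> (0::complex)"
    have "y n \<noteq> 0" if "y \<in> A" for y n
      using A(1) that solenoid_nonzero by blast
    with A show "continuous_on A (\<lambda>y. s y (r y))"
      unfolding s_def
    proof (intro continuous_on_coordinatewise_then_product)
      fix n
      show "continuous_on A (\<lambda>y. if n < N then r y ^ (\<Prod>i=n..<N. P i)
          else y n powi a n * r y powi b n)"
        using A \<open>\<And>y n. y \<in> A \<Longrightarrow> y n \<noteq> 0\<close>
        by (cases "n < N") (auto intro!: continuous_on_mult continuous_on_power
            continuous_on_power_int continuous_on_coordinate)
    qed
  qed
qed

section \<open>Roots on the circle and the sheets of the covering\<close>

lemma continuous_circle_root: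
  assumes "norm c = 1" "k > 0"
  obtains r where "continuous_on (sphere 0 1 - {- c}) r"
    "\<And>u. norm u = 1 \<Longrightarrow> r u ^ k = (u::complex)"
proof
  \<comment> \<open>Dividing by \<open>c\<close> turns the branch cut of \<open>Ln\<close> so that
    it meets the circle only in \<open>- c\<close>. At that point \<open>r\<close> is still a
    \<open>k\<close>-th root, but continuity is not claimed.\<close>
  define r where "r u = exp ((Ln c + Ln (u / c)) / of_nat k)" for u
  have c: "c \<noteq> 0" using assms by auto
  show "continuous_on (sphere 0 1 - {- c}) r"
  proof -
    have "u / c \<notin> \<real>\<^sub>\<le>\<^sub>0" if u: "u \<in> sphere 0 1 - {- c}" for u
    proof
      assume "u / c \<in> \<real>\<^sub>\<le>\<^sub>0"
      then obtain t where t: "u / c = of_real t" "t \<le> 0"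
        by (auto elim!: nonpos_Reals_cases)
      moreover have "norm (u / c) = 1"
        using u assms by (simp add: norm_divide)
      ultimately have "u / c = -1"
        by simp
      with u c show False
        by (simp add: field_simps)
    qed
    then show ?thesis
      unfolding r_def using c assms by (auto intro!: continuous_intros)
  qed
  show "r u ^ k = u" if "norm u = 1" for u
  proof -
    have "u \<noteq> 0" using that by auto
    with c assms show ?thesis
      by (simp add: r_def exp_add flip: exp_of_nat_mult)
  qed
qed

lemma norm_root_eq_1:
  fixes w :: complex
  assumes "norm (w ^ k) = 1" "k > 0"
  shows "norm w = 1"
  using assms power_eq_imp_eq_base[of "norm w" k 1] by (simp add: norm_power)

text \<open>The sheets near \<open>y\<close> correspond to the \<open>k\<close>-th roots of unity:
  with a continuous root \<open>r\<close> around \<open>y N\<close>, the sheet of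
  \<open>\<zeta>\<close> collects the preimages of \<open>x\<close> whose \<open>N\<close>-th
  coordinate is \<open>\<zeta> * r (x N)\<close>.\<close>

lemma kfold_covering_map_limit_map:
  assumes coprime: "\<And>n. n \<ge> N \<Longrightarrow> coprime (P n) k" and k: "k > 0"
  shows "kfold_covering_map k (solenoid P) (solenoid P) (limit_map k)"
proof -
  obtain s where s:
    "\<And>y w. y \<in> solenoid P \<Longrightarrow> w ^ k = y N \<Longrightarrow> norm w = 1 \<Longrightarrow>
       s y w \<in> solenoid P \<and> limit_map k (s y w) = y \<and> s y w N = w"
    and cont_s: "\<And>A r. A \<subseteq> solenoid P \<Longrightarrow> continuous_on A r \<Longrightarrow> (\<And>y. y \<in> A \<Longrightarrow> r y \<noteq> 0) \<Longrightarrow>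
       continuous_on A (\<lambda>y. s y (r y))"
    by (rule limit_map_lift[where P = P and k = k and N = N, OF coprime]) blast+
  have "\<exists>W. y \<in> W \<and> openin (top_of_set (solenoid P)) W \<and>
        (\<exists>\<V>. finite \<V> \<and> card \<V> = k \<and> \<Union>\<V> = solenoid P \<inter> limit_map k -` W \<and>
             (\<forall>V\<in>\<V>. openin (top_of_set (solenoid P)) V) \<and>
             pairwise disjnt \<V> \<and>
             (\<forall>V\<in>\<V>. \<exists>g. homeomorphism V W (limit_map k) g))"
    if y: "y \<in> solenoid P" for y
  proof -
    obtain r where cont_r: "continuous_on (sphere 0 1 - {- y N}) r"
      and r: "\<And>u. norm u = 1 \<Longrightarrow> r u ^ k = u"
      using continuous_circle_root[of "y N" k] norm_solenoid[OF y] k by blast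
    have nr: "norm (r u) = 1" if "norm u = 1" for u
      using that r k norm_root_eq_1 by metis
    \<comment> \<open>Only the antipode of \<open>y N\<close>, where the branch \<open>r\<close> may
      jump, is excluded.\<close>
    define W where "W = {x \<in> solenoid P. x N \<noteq> - y N}"
    define U where "U = {z \<in> solenoid P. z N ^ k \<noteq> - y N}"
    define R where "R = {\<zeta>::complex. \<zeta> ^ k = 1}"
    define V where "V \<zeta> = {z \<in> U. z N = \<zeta> * r (z N ^ k)}" for \<zeta>
    have U: "U = solenoid P \<inter> limit_map k -` W"
      using limit_map_in_solenoid by (auto simp: U_def W_def limit_map_def)
    have W_sub: "W \<subseteq> solenoid P" and U_sub: "U \<subseteq> solenoid P"
      by (auto simp: W_def U_def)
    have yW: "y \<in> W"
      using y solenoid_nonzero[OF y, of N] by (auto simp: W_def)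
    have W: "openin (top_of_set (solenoid P)) W"
    proof -
      have "W = solenoid P \<inter> (\<lambda>x. x N) -` (- {- y N})"
        by (auto simp: W_def)
      then show ?thesis
        using continuous_openin_preimage_gen[OF continuous_on_coordinate, of "- {- y N}"]
        by (simp add: open_Compl)
    qed
    then have openU: "openin (top_of_set (solenoid P)) U"
      unfolding U by (intro continuous_openin_preimage[OF continuous_on_limit_map])
        (auto simp: limit_map_in_solenoid)
    have R: "finite R" "card R = k"
      using k by (auto simp: R_def card_roots_unity_eq finite_roots_unity)
    have nz: "r (z N ^ k) \<noteq> 0" if "z \<in> U" for z
    proof -
      have "norm (r (z N ^ k)) = 1"
        using that U_sub by (intro nr) (auto simp: norm_power norm_solenoid)
      then show ?thesis by auto
    qed
    have in_R: "z N / r (z N ^ k) \<in> R" if "z \<in> U" for z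
    proof -
      have "norm (z N ^ k) = 1"
        using that U_sub by (auto simp: norm_power norm_solenoid)
      with that U_sub show ?thesis
        by (auto simp: R_def power_divide r solenoid_nonzero)
    qed
    \<comment> \<open>The sheets are the level sets of a continuous map from \<open>U\<close> into
      the finite, hence discrete, set \<open>R\<close>; so they are open and disjoint and cover
      \<open>U\<close>.\<close>
    have V_eq: "V \<zeta> = U \<inter> (\<lambda>z. z N / r (z N ^ k)) -` {\<zeta>}" for \<zeta>
      using nz by (auto simp: V_def field_simps)
    have "continuous_on U (\<lambda>z. r (z N ^ k))"
      by (rule continuous_on_compose2[OF cont_r])
         (auto simp: U_def norm_power norm_solenoid intro!: continuous_intros continuous_on_coordinate)
    then have "continuous_on U (\<lambda>z. z N / r (z N ^ k))"
      using nz by (intro continuous_intros continuous_on_coordinate) auto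
    moreover have "openin (top_of_set R) {\<zeta>}" if "\<zeta> \<in> R" for \<zeta>
      using that R by (simp add: openin_closedin_eq finite_imp_closedin)
    ultimately have "openin (top_of_set U) (V \<zeta>)" if "\<zeta> \<in> R" for \<zeta>
      unfolding V_eq using in_R that by (intro continuous_openin_preimage[where T = R]) auto
    then have openV: "openin (top_of_set (solenoid P)) (V \<zeta>)" if "\<zeta> \<in> R" for \<zeta>
      using openU openin_trans that by blast
    have lift: "s x (\<zeta> * r (x N)) \<in> V \<zeta> \<and> limit_map k (s x (\<zeta> * r (x N))) = x"
      if "x \<in> W" "\<zeta> \<in> R" for x \<zeta>
    proof -
      have x: "x \<in> solenoid P" "norm (x N) = 1"
        using that W_sub norm_solenoid by auto
      have \<zeta>: "\<zeta> ^ k = 1" using that by (simp add: R_def)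
      then have "norm \<zeta> = 1" using k norm_root_eq_1 by (metis norm_one)
      then have *: "s x (\<zeta> * r (x N)) \<in> solenoid P \<and> limit_map k (s x (\<zeta> * r (x N))) = x
            \<and> s x (\<zeta> * r (x N)) N = \<zeta> * r (x N)"
        using x \<zeta> by (intro s) (auto simp: power_mult_distrib r nr norm_mult)
      with that x \<zeta> show ?thesis
        by (auto simp: V_def U_def W_def power_mult_distrib r)
    qed
    have homeo: "homeomorphism (V \<zeta>) W (limit_map k) (\<lambda>x. s x (\<zeta> * r (x N)))" if \<zeta>: "\<zeta> \<in> R" for \<zeta>
    proof (rule homeomorphismI)
      show "continuous_on W (\<lambda>x. s x (\<zeta> * r (x N)))"
      proof (rule cont_s[OF W_sub])
        have "continuous_on W (\<lambda>x. r (x N))"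
          by (rule continuous_on_compose2[OF cont_r])
             (auto simp: W_def norm_solenoid intro!: continuous_on_coordinate)
        then show "continuous_on W (\<lambda>x. \<zeta> * r (x N))"
          by (intro continuous_intros)
        fix x assume "x \<in> W"
        then have "norm (r (x N)) = 1"
          using W_sub norm_solenoid nr by blast
        moreover have "\<zeta> \<noteq> 0"
          using \<zeta> k by (auto simp: R_def power_0_left)
        ultimately show "\<zeta> * r (x N) \<noteq> 0" by auto
      qed
      show lm: "limit_map k ` V \<zeta> \<subseteq> W"
        using U by (auto simp: V_def)
      \<comment> \<open>The point \<open>z\<close> and the lift of its image share image and
        \<open>N\<close>-th coordinate, so they agree.\<close>
      show "s (limit_map k z) (\<zeta> * r (limit_map k z N)) = z" if z: "z \<in> V \<zeta>" for z
      proof (rule solenoid_eqI[OF _ _ _ _ coprime])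
        have w: "norm (z N) = 1" "z \<in> solenoid P" "z N = \<zeta> * r (limit_map k z N)"
          using z U_sub norm_solenoid by (auto simp: V_def limit_map_def)
        show "z \<in> solenoid P" by fact
        have "s (limit_map k z) (z N) \<in> solenoid P \<and> limit_map k (s (limit_map k z) (z N)) = limit_map k z
            \<and> s (limit_map k z) (z N) N = z N"
          by (intro s limit_map_in_solenoid w) (simp add: limit_map_def)
        then show "s (limit_map k z) (\<zeta> * r (limit_map k z N)) \<in> solenoid P"
          "limit_map k (s (limit_map k z) (\<zeta> * r (limit_map k z N))) = limit_map k z"
          "s (limit_map k z) (\<zeta> * r (limit_map k z N)) N = z N"
          using w(3) by auto
      qed
    qed (use lift \<zeta> continuous_on_limit_map in auto)
    \<comment> \<open>Level sets of different roots are disjoint; being nonempty they are distinct,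
      so there are as many sheets as roots of unity.\<close>
    have "V \<zeta> \<noteq> {}" if "\<zeta> \<in> R" for \<zeta>
      using lift[OF yW that] by auto
    then have "inj_on V R"
      by (intro inj_onI) (auto simp: V_eq)
    then have "card (V ` R) = k"
      using R by (simp add: card_image)
    moreover have "\<Union> (V ` R) = U"
      using in_R by (auto simp: V_eq)
    moreover have "pairwise disjnt (V ` R)"
      by (auto simp: pairwise_def disjnt_def V_eq)
    ultimately have "finite (V ` R) \<and> card (V ` R) = k \<and> \<Union> (V ` R) = solenoid P \<inter> limit_map k -` W \<and>
             (\<forall>V\<in>V ` R. openin (top_of_set (solenoid P)) V) \<and>
             pairwise disjnt (V ` R) \<and>
             (\<forall>V\<in>V ` R. \<exists>g. homeomorphism V W (limit_map k) g)"
      using R openV homeo U by blast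
    with yW W show ?thesis
      by (intro exI[of _ W] exI[of _ "V ` R"] conjI) auto
  qed
  moreover have "limit_map k ` solenoid P = solenoid P"
  proof
    show "solenoid P \<subseteq> limit_map k ` solenoid P"
    proof
      fix y assume y: "y \<in> solenoid P"
      \<comment> \<open>Any \<open>k\<close>-th root of \<open>y N\<close> can be the
        \<open>N\<close>-th coordinate of a preimage.\<close>
      obtain w where w: "w ^ k = y N"
        using continuous_circle_root[of "y N" k] norm_solenoid[OF y] k by metis
      then have "norm w = 1"
        using norm_root_eq_1 k norm_solenoid[OF y] by metis
      with s y w show "y \<in> limit_map k ` solenoid P"
        by (metis imageI)
    qed
  qed (auto simp: limit_map_in_solenoid)
  ultimately show ?thesis
    by (simp add: kfold_covering_map_def continuous_on_limit_map)
qed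

section \<open>Fibres of coverings, and the kernel of the limit map\<close>

text \<open>Each sheet maps bijectively onto \<open>W\<close>, so it contains exactly one point over
  \<open>y\<close>, and every such point lies in just one sheet.\<close>

lemma kfold_covering_map_card_fibre:
  assumes "kfold_covering_map k X Y f" "y \<in> Y"
  shows "card (X \<inter> f -` {y}) = k"
proof -
  obtain W \<V> where W: "y \<in> W" and \<V>: "finite \<V>" "card \<V> = k" "\<Union>\<V> = X \<inter> f -` W"
    "pairwise disjnt \<V>" and homeo: "\<And>V. V \<in> \<V> \<Longrightarrow> \<exists>g. homeomorphism V W f g"
    using assms unfolding kfold_covering_map_def by meson
  have "\<forall>V\<in>\<V>. \<exists>x\<in>V. f x = y"
  proof
    fix V assume "V \<in> \<V>"
    then have "f ` V = W"
      using homeo homeomorphism_image1 by blast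
    with W show "\<exists>x\<in>V. f x = y"
      by auto
  qed
  then obtain g where g: "\<And>V. V \<in> \<V> \<Longrightarrow> g V \<in> V" "\<And>V. V \<in> \<V> \<Longrightarrow> f (g V) = y"
    by metis
  have "bij_betw g \<V> (X \<inter> f -` {y})"
  proof (rule bij_betw_imageI)
    show "inj_on g \<V>"
    proof (rule inj_onI, rule ccontr)
      fix U V assume *: "U \<in> \<V>" "V \<in> \<V>" "g U = g V" "U \<noteq> V"
      then have "disjnt U V"
        using \<V>(4) by (auto dest: pairwiseD)
      with g(1)[of U] g(1)[of V] * show False
        by (auto simp: disjnt_iff)
    qed
    show "g ` \<V> = X \<inter> f -` {y}"
    proof
      show "g ` \<V> \<subseteq> X \<inter> f -` {y}"
        using g \<V>(3) by blast
      show "X \<inter> f -` {y} \<subseteq> g ` \<V>"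
      proof
        fix x assume x: "x \<in> X \<inter> f -` {y}"
        then obtain V where V: "V \<in> \<V>" "x \<in> V"
          using \<V>(3) W by blast
        then have "x = g V"
          using homeo[OF V(1)] g[OF V(1)] x unfolding homeomorphism_def by auto metis
        with V show "x \<in> g ` \<V>" by blast
      qed
    qed
  qed
  then show ?thesis
    using \<V>(2) bij_betw_same_card by metis
qed

text \<open>Distinct points differ at some index and then at all later ones, since earlier
  coordinates are powers of later ones. With finitely many pairs, one index serves them all.\<close>

lemma finite_solenoid_subset_inj_on_coordinate:
  assumes "finite F" "F \<subseteq> solenoid P"
  obtains N where "inj_on (\<lambda>z. z N) F"
proof -
  have "\<forall>(z :: nat \<Rightarrow> complex) z'. \<exists>n. z \<noteq> z' \<longrightarrow> z n \<noteq> z' n"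
    by (auto simp: fun_eq_iff)
  then obtain d where d: "\<And>(z :: nat \<Rightarrow> complex) z'. z \<noteq> z' \<Longrightarrow> z (d z z') \<noteq> z' (d z z')"
    by metis
  obtain N where N: "\<And>z z'. z \<in> F \<Longrightarrow> z' \<in> F \<Longrightarrow> d z z' \<le> N"
    using finite_nat_set_iff_bounded_le[of "case_prod d ` (F \<times> F)"] assms(1) by force
  have "inj_on (\<lambda>z. z N) F"
  proof (intro inj_onI, rule ccontr)
    fix z z' assume *: "z \<in> F" "z' \<in> F" "z N = z' N" "z \<noteq> z'"
    then have "z (d z z') = z' (d z z')"
      using solenoid_power_prod[OF _ N[of z z']] assms(2) by (metis subsetD)
    with d[of z z'] * show False by simp
  qed
  then show thesis by (rule that)
qed

text \<open>For some \<open>j \<ge> n\<close> with \<open>P j = q\<close>, \<open>z n\<close> is a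
  power of \<open>z (Suc j)\<close> with exponent divisible by \<open>q\<close>; so
  \<open>z n ^ m\<close> is a power of \<open>z (Suc j) ^ (m * q) = 1\<close>.\<close>

lemma limit_map_kernel_power:
  assumes z: "z \<in> solenoid P" "limit_map (m * q) z = (\<lambda>_. 1)" and "infinite {n. P n = q}"
  shows "z n ^ m = 1"
proof -
  obtain j where j: "j \<ge> n" "P j = q"
    using assms(3) by (auto simp: infinite_nat_iff_unbounded_le)
  have "z n ^ m = (z (Suc j) ^ ((\<Prod>i=n..<j. P i) * q)) ^ m"
    using solenoid_power_prod[OF z(1), of n "Suc j"] j by simp
  also have "\<dots> = (z (Suc j) ^ (m * q)) ^ (\<Prod>i=n..<j. P i)"
    by (simp add: mult_ac flip: power_mult)
  also have "\<dots> = 1"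
    using z(2) by (simp add: limit_map_def fun_eq_iff)
  finally show ?thesis .
qed

section \<open>Prime divisors of \<open>k\<close> and their occurrences in \<open>P\<close>\<close>

theorem theorem1:
  fixes P :: "nat \<Rightarrow> nat" and k :: nat
  assumes "\<And>n. prime (P n)"
    and "k \<ge> 1"
  shows "kfold_covering_map k (solenoid P) (solenoid P) (limit_map k) \<longleftrightarrow>
         \<not> (\<exists>q. prime q \<and> q dvd k \<and> infinite {n. P n = q})"
proof
  assume cov: "kfold_covering_map k (solenoid P) (solenoid P) (limit_map k)"
  show "\<not> (\<exists>q. prime q \<and> q dvd k \<and> infinite {n. P n = q})"
  proof clarify
    fix q assume q: "prime q" "q dvd k" "infinite {n. P n = q}"
    then obtain m where m: "k = m * q"
      by (metis dvd_def mult.commute)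
    with assms(2) have "m > 0" by (auto intro: gr0I)
    define F where "F = solenoid P \<inter> limit_map k -` {\<lambda>_. 1}"
    have "card F = k"
      unfolding F_def by (rule kfold_covering_map_card_fibre[OF cov]) (simp add: solenoid_def)
    \<comment> \<open>An infinite \<open>F\<close> would have \<open>card F = 0\<close>.\<close>
    with assms(2) have "finite F"
      by (metis card.infinite not_one_le_zero)
    then obtain N where inj: "inj_on (\<lambda>z. z N) F"
      using finite_solenoid_subset_inj_on_coordinate[of F P] by (auto simp: F_def)
    have "(\<lambda>z. z N) ` F \<subseteq> {\<zeta>. \<zeta> ^ m = 1}"
      using q(3) by (auto simp: F_def m limit_map_kernel_power)
    then have "card F \<le> card {\<zeta>::complex. \<zeta> ^ m = 1}"
      using \<open>m > 0\<close> by (intro card_inj_on_le[OF inj] finite_roots_unity) auto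
    also have "\<dots> = m"
      using \<open>m > 0\<close> by (simp add: card_roots_unity_eq)
    finally show False
      using \<open>card F = k\<close> m \<open>m > 0\<close> prime_gt_1_nat[OF q(1)] by simp
  qed
next
  assume *: "\<not> (\<exists>q. prime q \<and> q dvd k \<and> infinite {n. P n = q})"
  \<comment> \<open>A prime \<open>P n\<close> dividing \<open>k\<close> is one of finitely many
    prime divisors, each occurring finitely often; beyond these indices \<open>P n\<close> is
    coprime to \<open>k\<close>.\<close>
  have "{n. P n dvd k} \<subseteq> (\<Union>q\<in>{q. prime q \<and> q dvd k}. {n. P n = q})"
    using assms(1) by auto
  moreover have "finite {q. prime q \<and> q dvd k}"
    using assms(2) by (intro finite_subset[OF _ finite_divisors_nat[of k]]) auto
  ultimately have "finite {n. P n dvd k}"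
    using * by (auto elim!: finite_subset)
  then obtain N where "\<And>n. P n dvd k \<Longrightarrow> n < N"
    by (auto simp: finite_nat_set_iff_bounded)
  then have "coprime (P n) k" if "n \<ge> N" for n
    using that assms(1) by (metis not_less prime_imp_coprime)
  then show "kfold_covering_map k (solenoid P) (solenoid P) (limit_map k)"
    using assms(2) by (intro kfold_covering_map_limit_map) auto
qed

end
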